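(* Let $\boldsymbol x^*\in\mathbb{U}^n$ and let $\boldsymbol a_1,\dots,\boldsymbol a_m\sim\mathcal N(\boldsymbol 0,\boldsymbol I_n)$ be independent random vectors in $\mathbb{R}^n$. Let $d_0\ge\tau_{k-1}$ and $\boldsymbol X=\boldsymbol x\boldsymbol x^\top$ with $\boldsymbol x\in\mathbb{U}^n$ fixed. Then, with probability at least $\left[\frac{\gamma\left(\frac{d_0}{2},\frac12\right)}{\sqrt\pi}\right]^m$, $$F(\boldsymbol X)\le \frac m2\max\left\{\delta^2,(d_0-\tau_{k-1})^2\right\}+(1-\rho_{\boldsymbol x}^2)\sum_{i=1}^m\left(\tilde a_{i1}^2+\tilde a_{i2}^2\right)^2,$$ where $\rho_{\boldsymbol x}=|\boldsymbol x^{*\top}\boldsymbol x|$, and $\tilde a_{i1},\tilde a_{i2}$ are the first two entries of $\tilde{\boldsymbol a}_i=\boldsymbol R^\top\boldsymbol a_i$, with $\boldsymbol R\boldsymbol D\boldsymbol R^\top$ the spectral decomposition of $\boldsymbol x^*\boldsymbol x^{*\top}-\boldsymbol x\boldsymbol x^\top$.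
   Context: $\mathbb{U}^n$ is the unit sphere of $\mathbb{R}^n$, $n\ge 2$. $\gamma(w,\alpha)=\int_0^w t^{\alpha-1}e^{-t}\,\mathrm dt$ is the lower incomplete gamma function. Quantizer: let $k\ge2$, with thresholds $0=\tau_0<\tau_1<\dots<\tau_{k-1}<\tau_k=+\infty$ and real symbols $s_1,\dots,s_k$ with $\tau_{j-1}<s_j<\tau_j$. Define $\mathcal Q(u)=s_j$ whenever $\tau_{j-1}\le u<\tau_j$. Its precision is $\delta=\max_{1\le j\le k-1}(\tau_j-\tau_{j-1})$. Measurements: $y_i=\mathcal Q(|\boldsymbol a_i^\top\boldsymbol x^*|^2)$, $i=1,\dots,m$. Let $j(i)$ denote the index with $y_i=s_{j(i)}$, and let $\boldsymbol A_i=\boldsymbol a_i\boldsymbol a_i^\top$. Cost: let $f(u)=\frac12u^2$ if $u\le0$ and $f(u)=0$ otherwise (with $f(+\infty)=0$). Define $$F(\boldsymbol X)=\sum_{i=1}^m\left[f\left(\tau_{j(i)}-\mathrm{Tr}(\boldsymbol A_i\boldsymbol X)\right)+f\left(\mathrm{Tr}(\boldsymbol A_i\boldsymbol X)-\tau_{j(i)-1}\right)\right].$$ Spectral decomposition convention: $\boldsymbol R$ is orthogonal and $\boldsymbol D$ is diagonal, ordered so that the (at most two) nonzero eigenvalues occupy the first two diagonal positions. *)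

theory Defs
  imports "HOL-Probability.Probability"
begin

definition lower_gamma :: "real \<Rightarrow> real \<Rightarrow> real" where
  "lower_gamma w \<alpha> = integral {0..w} (\<lambda>t. t powr (\<alpha> - 1) * exp (- t))"

text \<open>The law N(0, I) on n-dimensional space, by its density with respect to Lebesgue measure.\<close>

definition std_gaussian_vector :: "'w measure \<Rightarrow> ('w \<Rightarrow> real ^ 'n) \<Rightarrow> bool" where
  "std_gaussian_vector M X \<longleftrightarrow>
     distributed M lborel X (\<lambda>v. ennreal (\<Prod>l\<in>UNIV. std_normal_density (v $ l)))"

definition outer_square :: "real ^ 'n \<Rightarrow> real ^ 'n ^ 'n" where
  "outer_square v = (\<chi> r c. v $ r * v $ c)"

text \<open>
  The thresholds are extended reals because the last one is infinite.  Only the values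
  \<open>\<tau> 0, \<dots>, \<tau> k\<close> and \<open>s 1, \<dots>, s k\<close> are relevant.
\<close>

definition is_quantizer :: "nat \<Rightarrow> (nat \<Rightarrow> ereal) \<Rightarrow> (nat \<Rightarrow> real) \<Rightarrow> bool" where
  "is_quantizer k \<tau> s \<longleftrightarrow>
     2 \<le> k \<and> \<tau> 0 = 0 \<and> \<tau> k = \<infinity> \<and>
     (\<forall>j\<in>{1..k}. \<tau> (j - 1) < \<tau> j) \<and>
     (\<forall>j\<in>{1..k}. \<tau> (j - 1) < ereal (s j) \<and> ereal (s j) < \<tau> j)"

text \<open>
  For a quantizer and \<open>u \<ge> 0\<close>, exactly one index satisfies the description.
\<close>

definition quantize :: "nat \<Rightarrow> (nat \<Rightarrow> ereal) \<Rightarrow> (nat \<Rightarrow> real) \<Rightarrow> real \<Rightarrow> real" where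
  "quantize k \<tau> s u = s (THE j. j \<in> {1..k} \<and> \<tau> (j - 1) \<le> ereal u \<and> ereal u < \<tau> j)"

definition precision :: "nat \<Rightarrow> (nat \<Rightarrow> ereal) \<Rightarrow> real" where
  "precision k \<tau> = Max ((\<lambda>j. real_of_ereal (\<tau> j - \<tau> (j - 1))) ` {1..k - 1})"

text \<open>The symbols of a quantizer are pairwise distinct, so a symbol determines its index.\<close>

definition symbol_index :: "nat \<Rightarrow> (nat \<Rightarrow> real) \<Rightarrow> real \<Rightarrow> nat" where
  "symbol_index k s y = (THE j. j \<in> {1..k} \<and> y = s j)"

text \<open>
  Arguments of \<open>half_sq_neg\<close> below are never \<open>-\<infinity>\<close>; at \<open>\<infinity>\<close> the value is 0.
\<close>

definition half_sq_neg :: "ereal \<Rightarrow> real" where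
  "half_sq_neg u = (if u \<le> 0 then (real_of_ereal u)\<^sup>2 / 2 else 0)"

definition cost ::
  "nat \<Rightarrow> (nat \<Rightarrow> ereal) \<Rightarrow> (nat \<Rightarrow> real) \<Rightarrow> nat \<Rightarrow> (nat \<Rightarrow> real ^ 'n) \<Rightarrow> (nat \<Rightarrow> real)
    \<Rightarrow> real ^ 'n ^ 'n \<Rightarrow> real" where
  "cost k \<tau> s m a y X =
     (\<Sum>i=1..m.
        half_sq_neg (\<tau> (symbol_index k s (y i)) - ereal (trace (outer_square (a i) ** X))) +
        half_sq_neg (ereal (trace (outer_square (a i) ** X)) - \<tau> (symbol_index k s (y i) - 1)))"

text \<open>
  A finite index type carries no order, so the first two positions are passed as two
  indices \<open>p\<close> and \<open>q\<close>.
\<close>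

definition spectral_decomposition ::
  "'n \<Rightarrow> 'n \<Rightarrow> real ^ 'n ^ 'n \<Rightarrow> real ^ 'n ^ 'n \<Rightarrow> real ^ 'n ^ 'n \<Rightarrow> bool" where
  "spectral_decomposition p q H R D \<longleftrightarrow>
     orthogonal_matrix R \<and>
     (\<forall>r c. r \<noteq> c \<longrightarrow> D $ r $ c = 0) \<and>
     (\<forall>r. r \<noteq> p \<and> r \<noteq> q \<longrightarrow> D $ r $ r = 0) \<and>
     H = R ** D ** transpose R"

end

theory Submission
  imports Defs
begin

text \<open>
  The bound holds surely, not only with the stated probability, which is at most 1 since
  the lower incomplete gamma function is bounded by \<open>\<Gamma>(1/2) = \<surd>\<pi>\<close>.  The two quantities
  \<open>u = (a\<^sub>i \<bullet> x\<^sup>*)\<^sup>2\<close> and \<open>v = (a\<^sub>i \<bullet> x)\<^sup>2\<close> satisfy the following: \<open>u\<close> lies in its quantization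
  cell, so the \<open>i\<close>-th summand of the cost, half the squared distance from \<open>v\<close> to that cell, is at
  most \<open>(u - v)\<^sup>2 / 2\<close>.  Moreover \<open>u - v\<close> is the quadratic form of \<open>H = x\<^sup>* x\<^sup>*\<^sup>T - x x\<^sup>T\<close> at \<open>a\<^sub>i\<close>, and
  the eigenvalues of \<open>H\<close> follow from \<open>tr H = 0\<close> and \<open>tr H\<^sup>2 = 2 (1 - \<rho>\<^sup>2)\<close>: the two
  possibly nonzero ones are \<open>\<plusminus>\<surd>(1 - \<rho>\<^sup>2)\<close>.
\<close>

section \<open>Bounds for the lower incomplete gamma function\<close>

lemma lower_gamma_nonneg: "0 \<le> lower_gamma w \<alpha>"
  unfolding lower_gamma_def by (cases "(\<lambda>t. t powr (\<alpha> - 1) * exp (- t)) integrable_on {0..w}")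
    (auto intro: integral_nonneg simp: not_integrable_integral)

text \<open>The integrand is nonnegative and has integral \<open>Gamma \<alpha>\<close> over the
  half-line, which contains \<open>{0..w}\<close>. Since \<open>integral\<close> is 0 by convention
  for a nonintegrable function, a case split replaces a proof of integrability near 0.\<close>

lemma lower_gamma_le_Gamma:
  assumes "0 < \<alpha>"
  shows "lower_gamma w \<alpha> \<le> Gamma \<alpha>"
proof (cases "(\<lambda>t. t powr (\<alpha> - 1) * exp (- t)) integrable_on {0..w}")
  case True
  have I: "((\<lambda>t. t powr (\<alpha> - 1) * exp (- t)) has_integral Gamma \<alpha>) {0..}"
    using Gamma_integral_real[OF assms] by (simp add: exp_minus divide_inverse)
  show ?thesis
    unfolding lower_gamma_def
    by (rule has_integral_subset_le[OF _ integrable_integral[OF True] I]) auto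
next
  case False
  then show ?thesis
    using assms by (simp add: lower_gamma_def not_integrable_integral Gamma_real_pos less_imp_le)
qed

section \<open>Quantization cells and the summands of the cost\<close>

lemma half_sq_neg_cell_le:
  assumes "l \<le> ereal u" "ereal u \<le> h"
  shows "half_sq_neg (h - ereal v) + half_sq_neg (ereal v - l) \<le> (u - v)\<^sup>2 / 2"
proof -
  \<comment> \<open>If \<open>v\<close> lies above \<open>h\<close>, then
    \<open>u \<le> h \<le> v\<close>; if it lies below \<open>l\<close>, then
    \<open>v \<le> l \<le> u\<close>. In both cases the violated endpoint is at least as close to
    \<open>v\<close> as \<open>u\<close> is. The conditions in \<open>hi\<close> and
    \<open>lo\<close> overlap only at \<open>u = v\<close>, where both bounds are 0.\<close>
  have hi: "half_sq_neg (h - ereal v) \<le> (if u \<le> v then (u - v)\<^sup>2 / 2 else 0)"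
  proof (cases h)
    case (real r)
    then have "u \<le> r" using assms by simp
    have "(r - v)\<^sup>2 \<le> (u - v)\<^sup>2" if "r \<le> v"
      using that \<open>u \<le> r\<close> by (intro abs_le_square_iff[THEN iffD1]) simp
    then show ?thesis
      using real \<open>u \<le> r\<close> by (auto simp: half_sq_neg_def zero_ereal_def)
  qed (use assms in \<open>auto simp: half_sq_neg_def\<close>)
  have lo: "half_sq_neg (ereal v - l) \<le> (if v \<le> u then (u - v)\<^sup>2 / 2 else 0)"
  proof (cases l)
    case (real r)
    then have "r \<le> u" using assms by simp
    have "(v - r)\<^sup>2 \<le> (u - v)\<^sup>2" if "v \<le> r"
      using that \<open>r \<le> u\<close> by (intro abs_le_square_iff[THEN iffD1]) simp
    then show ?thesis
      using real \<open>r \<le> u\<close> by (auto simp: half_sq_neg_def zero_ereal_def)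
  qed (use assms in \<open>auto simp: half_sq_neg_def\<close>)
  show ?thesis
    using hi lo by (auto split: if_splits)
qed

lemma quantizer_mono:
  assumes "is_quantizer k \<tau> s" "i \<le> j" "j \<le> k"
  shows "\<tau> i \<le> \<tau> j"
  using assms(2,3)
proof (induction j rule: dec_induct)
  case (step j)
  have "\<tau> j < \<tau> (Suc j)"
    using assms(1) step.prems unfolding is_quantizer_def by (force dest: bspec[of _ _ "Suc j"])
  then show ?case using step by (auto intro: order.trans less_imp_le)
qed simp

lemma quantizer_symbol_index:
  assumes Q: "is_quantizer k \<tau> s" and j: "j \<in> {1..k}"
  shows "symbol_index k s (s j) = j"
  unfolding symbol_index_def
proof (rule the_equality)
  \<comment> \<open>A threshold separates any two symbols:
    \<open>s i < \<tau> i \<le> \<tau> (i' - 1) < s i'\<close>.\<close>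
  have less: "s i < s i'" if "i \<in> {1..k}" "i' \<in> {1..k}" "i < i'" for i i'
  proof -
    have "ereal (s i) < \<tau> i" "\<tau> (i' - 1) < ereal (s i')"
      using Q that unfolding is_quantizer_def by auto
    moreover have "\<tau> i \<le> \<tau> (i' - 1)"
      using that by (intro quantizer_mono[OF Q]) auto
    ultimately have "ereal (s i) < ereal (s i')" by (metis order.strict_trans1 order.strict_trans)
    then show ?thesis by simp
  qed
  show "i = j" if "i \<in> {1..k} \<and> s j = s i" for i
    using that j less[of i j] less[of j i] by (cases i j rule: linorder_cases) auto
qed (use j in simp)

lemma quantize_cell:
  assumes Q: "is_quantizer k \<tau> s" and "0 \<le> u"
  defines "j \<equiv> symbol_index k s (quantize k \<tau> s u)"
  shows "\<tau> (j - 1) \<le> ereal u" "ereal u < \<tau> j"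
proof -
  let ?P = "\<lambda>j. j \<in> {1..k} \<and> \<tau> (j - 1) \<le> ereal u \<and> ereal u < \<tau> j"
  \<comment> \<open>The index of the cell: it exists and is at most \<open>k\<close> because
    \<open>\<tau> k\<close> is infinite, it is nonzero because \<open>\<tau> 0 = 0 \<le> u\<close>,
    and its minimality gives the lower threshold.\<close>
  define c where "c = (LEAST j. ereal u < \<tau> j)"
  have top: "ereal u < \<tau> k" and bot: "\<not> ereal u < \<tau> 0"
    using Q \<open>0 \<le> u\<close> by (auto simp: is_quantizer_def)
  have c: "ereal u < \<tau> c" "c \<le> k"
    unfolding c_def using top by (rule LeastI, rule Least_le)
  have "c \<noteq> 0" using c(1) bot by metis
  moreover have "\<not> ereal u < \<tau> (c - 1)"
    using \<open>c \<noteq> 0\<close> not_less_Least[of "c - 1" "\<lambda>j. ereal u < \<tau> j"] by (simp add: c_def)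
  ultimately have Pc: "?P c" using c by auto
  have "i = c" if "?P i" for i
  proof (rule ccontr)
    assume "i \<noteq> c"
    then have "\<tau> i \<le> \<tau> (c - 1) \<or> \<tau> c \<le> \<tau> (i - 1)"
      using that Pc by (cases i c rule: linorder_cases) (auto intro!: quantizer_mono[OF Q])
    then show False
      using that Pc by (meson leD order.trans)
  qed
  with Pc have "(THE j. ?P j) = c" by (rule the_equality)
  then have "j = c"
    using Pc quantizer_symbol_index[OF Q] by (simp add: j_def quantize_def)
  with Pc show "\<tau> (j - 1) \<le> ereal u" "ereal u < \<tau> j" by auto
qed

section \<open>Rank-one matrices and the spectrum of their difference\<close>

lemma outer_square_mult_vec: "outer_square v *v w = (v \<bullet> w) *\<^sub>R v"
  by (simp add: vec_eq_iff outer_square_def matrix_vector_mult_def inner_vec_def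
      sum_distrib_left sum_distrib_right algebra_simps)

lemma trace_outer_square_mult: "trace (outer_square v ** B) = v \<bullet> (B *v v)"
proof -
  have "trace (outer_square v ** B) = (\<Sum>r\<in>UNIV. \<Sum>c\<in>UNIV. v $ r * v $ c * B $ c $ r)"
    by (simp add: trace_def matrix_matrix_mult_def outer_square_def)
  also have "\<dots> = (\<Sum>c\<in>UNIV. \<Sum>r\<in>UNIV. v $ r * v $ c * B $ c $ r)"
    by (rule sum.swap)
  finally show ?thesis
    by (simp add: inner_vec_def matrix_vector_mult_def sum_distrib_left algebra_simps)
qed

lemma trace_outer_square: "trace (outer_square v) = v \<bullet> v"
  by (simp add: trace_def outer_square_def inner_vec_def)

text \<open>Two numbers with known sum and known sum of squares are determined up to order, so no
  eigenvector is computed. Either of \<open>p\<close> and \<open>q\<close> may carry the positive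
  eigenvalue, hence the squared form.\<close>

lemma spectral_eigenvalues_sq:
  fixes xs x :: "real ^ 'n"
  assumes "norm xs = 1" "norm x = 1" "p \<noteq> q"
    and S: "spectral_decomposition p q (outer_square xs - outer_square x) R D"
  shows "(D $ p $ p)\<^sup>2 = 1 - (xs \<bullet> x)\<^sup>2" "D $ q $ q = - (D $ p $ p)"
proof -
  let ?H = "outer_square xs - outer_square x"
  have R: "transpose R ** R = mat 1" and H: "?H = R ** D ** transpose R"
    and off: "\<And>r c. r \<noteq> c \<Longrightarrow> D $ r $ c = 0"
    and zero: "\<And>r. r \<noteq> p \<Longrightarrow> r \<noteq> q \<Longrightarrow> D $ r $ r = 0"
    using S by (auto simp: spectral_decomposition_def orthogonal_matrix_def)
  have unit: "xs \<bullet> xs = 1" "x \<bullet> x = 1"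
    using assms by (auto simp: dot_square_norm)
  have two: "(\<Sum>r\<in>UNIV. g r) = g p + g q" if "\<And>r. r \<noteq> p \<Longrightarrow> r \<noteq> q \<Longrightarrow> g r = 0" for g :: "'n \<Rightarrow> real"
  proof -
    have "(\<Sum>r\<in>UNIV. g r) = sum g {p, q}"
      using that by (intro sum.mono_neutral_right) auto
    then show ?thesis using \<open>p \<noteq> q\<close> by simp
  qed
  have conj: "trace (R ** E ** transpose R) = trace E" for E :: "real ^ 'n ^ 'n"
    using trace_mul_sym[of "R ** E" "transpose R"] R by (simp add: matrix_mul_assoc)
  have "trace ?H = 0"
    by (simp add: trace_sub trace_outer_square unit)
  then have "trace D = 0" using H conj by metis
  moreover have "trace D = D $ p $ p + D $ q $ q"
    unfolding trace_def by (rule two) (rule zero)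
  ultimately show opp: "D $ q $ q = - (D $ p $ p)" by simp
  have "?H ** ?H = R ** D ** (transpose R ** R) ** D ** transpose R"
    unfolding H by (simp only: matrix_mul_assoc)
  also have "\<dots> = R ** (D ** D) ** transpose R"
    unfolding R by (simp add: matrix_mul_assoc)
  finally have "trace (?H ** ?H) = trace (D ** D)" by (simp add: conj)
  also have "\<dots> = (\<Sum>r\<in>UNIV. (D $ r $ r)\<^sup>2)"
  proof -
    have "(\<Sum>c\<in>UNIV. D $ r $ c * D $ c $ r) = (D $ r $ r)\<^sup>2" for r
    proof -
      have "(\<Sum>c\<in>UNIV. D $ r $ c * D $ c $ r) = (\<Sum>c\<in>{r}. D $ r $ c * D $ c $ r)"
        using off by (intro sum.mono_neutral_right) auto
      then show ?thesis by (simp add: power2_eq_square)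
    qed
    then show ?thesis by (simp add: trace_def matrix_matrix_mult_def)
  qed
  also have "\<dots> = 2 * (D $ p $ p)\<^sup>2"
    using two[of "\<lambda>r. (D $ r $ r)\<^sup>2"] zero opp by simp
  finally have "trace (?H ** ?H) = 2 * (D $ p $ p)\<^sup>2" .
  moreover have "trace (?H ** ?H) = 2 * (1 - (xs \<bullet> x)\<^sup>2)"
  proof -
    \<comment> \<open>Splitting only the left factor leaves quadratic forms of \<open>?H\<close> at
      \<open>xs\<close> and at \<open>x\<close>, whose values are
      \<open>1 - (xs \<bullet> x)^2\<close> and its negative.\<close>
    have "trace (?H ** ?H) = xs \<bullet> (?H *v xs) - x \<bullet> (?H *v x)"
    proof -
      have "?H ** ?H = outer_square xs ** ?H - outer_square x ** ?H"
        by (simp add: vec_eq_iff matrix_matrix_mult_def left_diff_distrib sum_subtractf)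
      then show ?thesis
        by (simp only: trace_sub trace_outer_square_mult)
    qed
    then show ?thesis
      by (simp add: matrix_vector_mult_diff_rdistrib outer_square_mult_vec unit inner_diff_right
          inner_commute[of x xs] power2_eq_square)
  qed
  ultimately show "(D $ p $ p)\<^sup>2 = 1 - (xs \<bullet> x)\<^sup>2" by simp
qed

text \<open>Moving \<open>R\<close> across the inner product turns \<open>v\<close> into
  \<open>transpose R *v v\<close>; in these coordinates the form is diagonal and only
  \<open>p\<close> and \<open>q\<close> contribute.\<close>

lemma spectral_decomposition_quadratic_form:
  fixes H :: "real ^ 'n ^ 'n"
  assumes S: "spectral_decomposition p q H R D" and "p \<noteq> q"
  shows "v \<bullet> (H *v v) = D $ p $ p * ((transpose R *v v) $ p)\<^sup>2 + D $ q $ q * ((transpose R *v v) $ q)\<^sup>2"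
proof -
  have H: "H = R ** D ** transpose R"
    and off: "\<And>r c. r \<noteq> c \<Longrightarrow> D $ r $ c = 0"
    and zero: "\<And>r. r \<noteq> p \<Longrightarrow> r \<noteq> q \<Longrightarrow> D $ r $ r = 0"
    using S by (auto simp: spectral_decomposition_def)
  define w where "w = transpose R *v v"
  have "v \<bullet> (H *v v) = v \<bullet> (R *v (D *v w))"
    by (simp add: H w_def matrix_vector_mul_assoc matrix_mul_assoc del: transpose_matrix_vector)
  also have "\<dots> = w \<bullet> (D *v w)"
    by (simp add: w_def dot_lmul_matrix[symmetric])
  also have "\<dots> = (\<Sum>r\<in>UNIV. D $ r $ r * (w $ r)\<^sup>2)"
  proof -
    have "(\<Sum>c\<in>UNIV. D $ r $ c * w $ c) = D $ r $ r * w $ r" for r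
    proof -
      have "(\<Sum>c\<in>UNIV. D $ r $ c * w $ c) = (\<Sum>c\<in>{r}. D $ r $ c * w $ c)"
        using off by (intro sum.mono_neutral_right) auto
      then show ?thesis by simp
    qed
    then show ?thesis
      by (simp add: inner_vec_def matrix_vector_mult_def power2_eq_square algebra_simps)
  qed
  also have "\<dots> = (\<Sum>r\<in>{p, q}. D $ r $ r * (w $ r)\<^sup>2)"
    using zero by (intro sum.mono_neutral_right) auto
  finally show ?thesis
    using \<open>p \<noteq> q\<close> by (simp add: w_def)
qed

lemma lifted_difference_sq_le:
  fixes xs x v :: "real ^ 'n"
  assumes "norm xs = 1" "norm x = 1" "p \<noteq> q"
    and S: "spectral_decomposition p q (outer_square xs - outer_square x) R D"
  shows "((v \<bullet> xs)\<^sup>2 - (v \<bullet> x)\<^sup>2)\<^sup>2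
    \<le> (1 - (xs \<bullet> x)\<^sup>2) * (((transpose R *v v) $ p)\<^sup>2 + ((transpose R *v v) $ q)\<^sup>2)\<^sup>2"
proof -
  let ?b = "((transpose R *v v) $ p)\<^sup>2" and ?c = "((transpose R *v v) $ q)\<^sup>2"
  note eig = spectral_eigenvalues_sq[OF assms]
  have "(v \<bullet> xs)\<^sup>2 - (v \<bullet> x)\<^sup>2 = v \<bullet> ((outer_square xs - outer_square x) *v v)"
    by (simp add: matrix_vector_mult_diff_rdistrib outer_square_mult_vec inner_diff_right
        inner_commute power2_eq_square)
  also have "\<dots> = D $ p $ p * (?b - ?c)"
    unfolding spectral_decomposition_quadratic_form[OF S \<open>p \<noteq> q\<close>] eig(2) by (simp only: algebra_simps)
  finally have "((v \<bullet> xs)\<^sup>2 - (v \<bullet> x)\<^sup>2)\<^sup>2 = (D $ p $ p)\<^sup>2 * (?b - ?c)\<^sup>2"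
    by (simp add: power_mult_distrib)
  \<comment> \<open>\<open>?b\<close> and \<open>?c\<close> are squares, so the absolute value of
    their difference is at most their sum.\<close>
  also have "\<dots> \<le> (D $ p $ p)\<^sup>2 * (?b + ?c)\<^sup>2"
    by (intro mult_left_mono abs_le_square_iff[THEN iffD1]) (auto simp: abs_le_iff)
  finally show ?thesis by (simp add: eig(1))
qed

section \<open>From the cost to the probability bound\<close>

lemma cost_quantize_le:
  fixes a :: "nat \<Rightarrow> real ^ 'n"
  assumes Q: "is_quantizer k \<tau> s"
  shows "cost k \<tau> s m a (\<lambda>i. quantize k \<tau> s (\<bar>a i \<bullet> xs\<bar>\<^sup>2)) (outer_square x)
    \<le> (\<Sum>i=1..m. ((a i \<bullet> xs)\<^sup>2 - (a i \<bullet> x)\<^sup>2)\<^sup>2 / 2)"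
  unfolding cost_def
proof (rule sum_mono)
  fix i
  have "trace (outer_square (a i) ** outer_square x) = (a i \<bullet> x)\<^sup>2"
    by (simp add: trace_outer_square_mult outer_square_mult_vec inner_commute power2_eq_square)
  then show "half_sq_neg (\<tau> (symbol_index k s (quantize k \<tau> s (\<bar>a i \<bullet> xs\<bar>\<^sup>2)))
        - ereal (trace (outer_square (a i) ** outer_square x)))
      + half_sq_neg (ereal (trace (outer_square (a i) ** outer_square x))
        - \<tau> (symbol_index k s (quantize k \<tau> s (\<bar>a i \<bullet> xs\<bar>\<^sup>2)) - 1))
      \<le> ((a i \<bullet> xs)\<^sup>2 - (a i \<bullet> x)\<^sup>2)\<^sup>2 / 2"
    using half_sq_neg_cell_le quantize_cell[OF Q, of "(a i \<bullet> xs)\<^sup>2"] by (simp add: less_imp_le)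
qed

theorem proposition4:
  fixes M :: "'w measure"
    and a :: "nat \<Rightarrow> 'w \<Rightarrow> real ^ 'n"
    and xs x :: "real ^ 'n"
    and k m :: nat
    and \<tau> :: "nat \<Rightarrow> ereal"
    and s :: "nat \<Rightarrow> real"
    and d0 :: real
    and R D :: "real ^ 'n ^ 'n"
    and p q :: 'n
  assumes "CARD('n) \<ge> 2"
    and "is_quantizer k \<tau> s"
    and "prob_space M"
    and "\<And>i. i \<in> {1..m} \<Longrightarrow> std_gaussian_vector M (a i)"
    and "prob_space.indep_vars M (\<lambda>_. borel) a {1..m}"
    and "xs \<in> sphere 0 1"
    and "x \<in> sphere 0 1"
    and "ereal d0 \<ge> \<tau> (k - 1)"
    and "p \<noteq> q"
    and "spectral_decomposition p q (outer_square xs - outer_square x) R D"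
  shows "measure M {\<omega> \<in> space M.
           cost k \<tau> s m (\<lambda>i. a i \<omega>) (\<lambda>i. quantize k \<tau> s (\<bar>a i \<omega> \<bullet> xs\<bar>\<^sup>2)) (outer_square x)
           \<le> real m / 2 * max ((precision k \<tau>)\<^sup>2) ((d0 - real_of_ereal (\<tau> (k - 1)))\<^sup>2)
             + (1 - \<bar>xs \<bullet> x\<bar>\<^sup>2) *
               (\<Sum>i=1..m. (((transpose R *v a i \<omega>) $ p)\<^sup>2 + ((transpose R *v a i \<omega>) $ q)\<^sup>2)\<^sup>2)}
         \<ge> (lower_gamma (d0 / 2) (1 / 2) / sqrt pi) ^ m"
proof -
  have norms: "norm xs = 1" "norm x = 1"
    using assms(6,7) by auto
  let ?e = "\<lambda>v. ((transpose R *v v) $ p)\<^sup>2 + ((transpose R *v v) $ q)\<^sup>2"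
  let ?B = "\<lambda>\<omega>. real m / 2 * max ((precision k \<tau>)\<^sup>2) ((d0 - real_of_ereal (\<tau> (k - 1)))\<^sup>2)
             + (1 - \<bar>xs \<bullet> x\<bar>\<^sup>2) * (\<Sum>i=1..m. (?e (a i \<omega>))\<^sup>2)"
  let ?cost = "\<lambda>\<omega>. cost k \<tau> s m (\<lambda>i. a i \<omega>) (\<lambda>i. quantize k \<tau> s (\<bar>a i \<omega> \<bullet> xs\<bar>\<^sup>2)) (outer_square x)"
  have sure: "?cost \<omega> \<le> ?B \<omega>" for \<omega>
  proof -
    have "?cost \<omega> \<le> (\<Sum>i=1..m. ((a i \<omega> \<bullet> xs)\<^sup>2 - (a i \<omega> \<bullet> x)\<^sup>2)\<^sup>2 / 2)"
      by (rule cost_quantize_le[OF assms(2)])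
    also have "\<dots> \<le> (\<Sum>i=1..m. ((a i \<omega> \<bullet> xs)\<^sup>2 - (a i \<omega> \<bullet> x)\<^sup>2)\<^sup>2)"
      by (rule sum_mono) simp
    also have "\<dots> \<le> (\<Sum>i=1..m. (1 - (xs \<bullet> x)\<^sup>2) * (?e (a i \<omega>))\<^sup>2)"
      by (rule sum_mono) (rule lifted_difference_sq_le[OF norms assms(9,10)])
    also have "\<dots> = (1 - \<bar>xs \<bullet> x\<bar>\<^sup>2) * (\<Sum>i=1..m. (?e (a i \<omega>))\<^sup>2)"
      by (simp add: sum_distrib_left)
    \<comment> \<open>The quantization term that \<open>?B\<close> adds is nonnegative.\<close>
    also have "\<dots> \<le> ?B \<omega>"
      by (simp add: le_max_iff_disj)
    finally show ?thesis .
  qed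
  \<comment> \<open>The normalizing constant is \<open>Gamma (1 / 2) = sqrt pi\<close>, so the base
    of the power lies between 0 and 1.\<close>
  have "lower_gamma (d0 / 2) (1 / 2) \<le> sqrt pi"
    using lower_gamma_le_Gamma[of "1 / 2"] by (simp add: Gamma_one_half_real)
  then have "(lower_gamma (d0 / 2) (1 / 2) / sqrt pi) ^ m \<le> 1"
    by (intro power_le_one) (auto simp: lower_gamma_nonneg)
  \<comment> \<open>By \<open>sure\<close> the event is all of \<open>space M\<close>, which also
    settles its measurability.\<close>
  also have "1 = measure M {\<omega> \<in> space M. ?cost \<omega> \<le> ?B \<omega>}"
    using sure prob_space.prob_space[OF assms(3)] by simp
  finally show ?thesis .
qed

end
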